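(* Assume that $N$ satellites are distributed independently and uniformly on a sphere of radius $r_{\oplus}+r_{\mathrm{min}}$ concentric with Earth, and that a user, located arbitrarily on the surface of Earth (a sphere of radius $r_{\oplus}$), is associated with the nearest satellite (the serving satellite). Let $T>0$ be an SNR threshold. Then the probability of network coverage for the arbitrarily located user under general fading is $$P_{\mathrm{c}}(T)\triangleq\mathbb{P}(\mathrm{SNR}>T)=\frac{N}{2r_{\oplus}(r_{\oplus}+r_{\mathrm{min}})}\int_{r_{\mathrm{min}}}^{r_{\mathrm{max}}}\left(1-F_{G_0}\!\left(\frac{T r_0^{\alpha}\sigma^2}{p_{\mathrm{s}}}\right)\right)\left(1-\frac{r_0^2-r_{\mathrm{min}}^2}{4r_{\oplus}(r_{\oplus}+r_{\mathrm{min}})}\right)^{N-1} r_0\,dr_0 ,$$ where $F_{G_0}(\cdot)$ is the cumulative distribution function of the channel gain $G_0$ of the serving link.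
   Context: Here $r_{\oplus}$ is Earth's radius (Earth is approximated as a perfect sphere) and $r_{\mathrm{min}}$ is the satellites' altitude, which is also the minimum possible distance between a satellite and a user. Transmissions propagate between the user and all and only the satellites whose elevation angle above the horizon is at least $\theta_{\mathrm{min}}$. The maximum possible distance at which a satellite and the user may be able to communicate (realized at elevation $\theta_{\mathrm{min}}$) is $r_{\mathrm{max}}$, given by $$\frac{r_{\mathrm{max}}}{r_{\oplus}}=\sqrt{\frac{r_{\mathrm{min}}}{r_{\oplus}}\left(\frac{r_{\mathrm{min}}}{r_{\oplus}}+2\right)+\sin^2(\theta_{\mathrm{min}})}-\sin(\theta_{\mathrm{min}}).$$ The distance from the user to the serving satellite is the random variable $R_0$ (values denoted $r_0$), and $G_0$ is the corresponding random channel gain, with $G_0=0$ if $r_0>r_{\mathrm{max}}$; "general fading" means that no particular distribution of the channel gain is prescribed. Interference is assumed to be mitigated so that the network is noise-limited, and the signal-to-noise ratio at the receiver is $$\mathrm{SNR}=\begin{cases}\dfrac{p_{\mathrm{s}}\,G_0\,r_0^{-\alpha}}{\sigma^2}, & r_0\le r_{\mathrm{max}},\\[1ex] 0, & \text{otherwise,}\end{cases}$$ where $p_{\mathrm{s}}$ is the transmission power, $\sigma^2$ is the constant power of the additive white Gaussian noise, and $\alpha$ is the path loss exponent.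
   Formalization: The gain G_0 is assumed independent of the serving distance R_0 given R_0 ≤ r_max, and F_{G_0} is the CDF of G_0 conditioned on R_0 ≤ r_max; with the unconditional CDF (G_0 = 0 out of range), or with gain depending on distance, the formula fails. *)

theory Defs
  imports "HOL-Probability.Probability"
begin

text \<open>
  Surface area on the sphere of radius \<open>R\<close> about the origin of three-dimensional space.
  The cone with apex \<open>0\<close> over a piece \<open>A\<close> of the sphere has volume \<open>R / 3\<close> times the
  area of \<open>A\<close>, so the area is \<open>3 / R\<close> times the volume of
  \<open>{x. norm x < R \<and> (R / norm x) *\<^sub>R x \<in> A}\<close>. As a measure on the whole space it is
  concentrated on the sphere; its total mass and its invariance under orthogonal
  transformations are proved below.
\<close>

definition sphere_area :: "real \<Rightarrow> (real ^ 3) measure" where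
  "sphere_area R = scale_measure (ennreal (3 / R))
     (distr (restrict_space lborel (ball 0 R)) borel (\<lambda>x. (R / norm x) *\<^sub>R x))"

definition uniform_sphere :: "real \<Rightarrow> (real ^ 3) measure" where
  "uniform_sphere R = uniform_measure (sphere_area R) (sphere 0 R)"

text \<open>
  With ties (a null event) \<^const>\<open>arg_min_on\<close> picks one of the nearest satellites; the
  distance does not depend on the choice.
\<close>

definition serving_satellite ::
    "nat \<Rightarrow> (nat \<Rightarrow> 'w \<Rightarrow> real ^ 3) \<Rightarrow> real ^ 3 \<Rightarrow> 'w \<Rightarrow> nat" where
  "serving_satellite N X u \<omega> = arg_min_on (\<lambda>i. dist u (X i \<omega>)) {..<N}"

definition serving_distance ::
    "nat \<Rightarrow> (nat \<Rightarrow> 'w \<Rightarrow> real ^ 3) \<Rightarrow> real ^ 3 \<Rightarrow> 'w \<Rightarrow> real" where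
  "serving_distance N X u \<omega> = dist u (X (serving_satellite N X u \<omega>) \<omega>)"

definition max_distance :: "real \<Rightarrow> real \<Rightarrow> real \<Rightarrow> real" where
  "max_distance r_earth r_min \<theta>_min = r_earth *
     (sqrt (r_min / r_earth * (r_min / r_earth + 2) + (sin \<theta>_min)\<^sup>2) - sin \<theta>_min)"

definition snr :: "real \<Rightarrow> real \<Rightarrow> real \<Rightarrow> real \<Rightarrow> real \<Rightarrow> real \<Rightarrow> real" where
  "snr p \<sigma> \<alpha> r_max g r = (if r \<le> r_max then p * g * r powr (- \<alpha>) / \<sigma>\<^sup>2 else 0)"

text \<open>
  The underlying probability space conditioned on the serving satellite being in range,
  that is, on the serving link existing. Outside that event the gain is set to \<open>0\<close> by
  convention, which says nothing about fading, so the law of the gain of the serving link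
  is its law under this conditional measure.
\<close>

definition given_link :: "'w measure \<Rightarrow> ('w \<Rightarrow> real) \<Rightarrow> real \<Rightarrow> 'w measure" where
  "given_link M R\<^sub>0 r_max = uniform_measure M {\<omega> \<in> space M. R\<^sub>0 \<omega> \<le> r_max}"

definition link_gain_cdf ::
    "'w measure \<Rightarrow> ('w \<Rightarrow> real) \<Rightarrow> real \<Rightarrow> ('w \<Rightarrow> real) \<Rightarrow> real \<Rightarrow> real" where
  "link_gain_cdf M R\<^sub>0 r_max G\<^sub>0 = cdf (distr (given_link M R\<^sub>0 r_max) borel G\<^sub>0)"

lemma sets_sphere_area [simp, measurable_cong]: "sets (sphere_area R) = sets borel"
  by (simp add: sphere_area_def)

lemma sets_uniform_sphere [simp, measurable_cong]: "sets (uniform_sphere R) = sets borel"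
  by (simp add: uniform_sphere_def)

lemma space_uniform_sphere [simp]: "space (uniform_sphere R) = UNIV"
  using sets_eq_imp_space_eq[OF sets_uniform_sphere] by simp

lemma emeasure_sphere_area:
  assumes "A \<in> sets borel"
  shows "emeasure (sphere_area R) A =
    ennreal (3 / R) * emeasure lborel {x \<in> ball 0 R. (R / norm x) *\<^sub>R x \<in> A}"
proof -
  have m: "(\<lambda>x::real^3. (R / norm x) *\<^sub>R x) \<in> measurable (restrict_space lborel (ball 0 R)) borel"
    by (rule measurable_restrict_space1) measurable
  have "emeasure (distr (restrict_space lborel (ball 0 R)) borel (\<lambda>x::real^3. (R / norm x) *\<^sub>R x)) A
      = emeasure (restrict_space lborel (ball 0 R))
          ((\<lambda>x::real^3. (R / norm x) *\<^sub>R x) -` A \<inter> ball 0 R)"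
    using assms m by (subst emeasure_distr) (auto simp: space_restrict_space)
  also have "\<dots> = emeasure lborel ((\<lambda>x::real^3. (R / norm x) *\<^sub>R x) -` A \<inter> ball 0 R)"
    by (rule emeasure_restrict_space) auto
  also have "(\<lambda>x::real^3. (R / norm x) *\<^sub>R x) -` A \<inter> ball 0 R
      = {x \<in> ball 0 R. (R / norm x) *\<^sub>R x \<in> A}" by auto
  finally show ?thesis by (simp add: sphere_area_def)
qed

lemma sphere_area_total:
  assumes "R > 0"
  shows "emeasure (sphere_area R) (sphere 0 R) = ennreal (4 * pi * R\<^sup>2)"
    and "emeasure (sphere_area R) (- sphere 0 R) = 0"
proof -
  have eq: "{x \<in> ball 0 R. (R / norm x) *\<^sub>R x \<in> sphere 0 R} = ball (0::real^3) R - {0}"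
    using assms by auto
  have "emeasure lborel (ball (0::real^3) R - {0}) = emeasure lborel (ball (0::real^3) R)"
    by (rule emeasure_Diff_null_set) auto
  also have "\<dots> = ennreal (4 / 3 * pi * R ^ 3)"
    using assms by (simp add: emeasure_ball unit_ball_vol_3)
  finally have vol: "emeasure lborel (ball (0::real^3) R - {0}) = ennreal (4 / 3 * pi * R ^ 3)" .
  have "emeasure (sphere_area R) (sphere 0 R) = ennreal (3 / R) * ennreal (4 / 3 * pi * R ^ 3)"
    unfolding vol[symmetric] eq[symmetric] by (rule emeasure_sphere_area) simp
  also have "\<dots> = ennreal (3 / R * (4 / 3 * pi * R ^ 3))"
    by (rule ennreal_mult[symmetric]) (use assms in auto)
  also have "3 / R * (4 / 3 * pi * R ^ 3) = 4 * pi * R\<^sup>2"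
    using assms by (simp add: power2_eq_square power3_eq_cube)
  finally show "emeasure (sphere_area R) (sphere 0 R) = ennreal (4 * pi * R\<^sup>2)" .
  have eq': "{x \<in> ball 0 R. (R / norm x) *\<^sub>R x \<in> - sphere 0 R} = {0::real^3}"
    using assms by auto
  show "emeasure (sphere_area R) (- sphere 0 R) = 0"
    by (subst emeasure_sphere_area) (simp_all only: eq', simp_all)
qed

lemma prob_space_uniform_sphere:
  assumes "R > 0"
  shows "prob_space (uniform_sphere R)"
  unfolding uniform_sphere_def
  by (rule prob_space_uniform_measure) (use assms in \<open>auto simp: sphere_area_total\<close>)

lemma uniform_sphere_orthogonal_invariant:
  fixes f :: "real ^ 3 \<Rightarrow> real ^ 3"
  assumes f: "orthogonal_transformation f"
  shows "distr (uniform_sphere R) borel f = uniform_sphere R"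
proof -
  have lin: "linear f" and nf: "\<And>x. norm (f x) = norm x"
    using f by (auto simp: orthogonal_transformation)
  have mf [measurable]: "f \<in> borel_measurable borel"
    by (intro borel_measurable_continuous_onI linear_continuous_on
          linear_conv_bounded_linear[THEN iffD1] lin)
  have inv: "emeasure (sphere_area R) (f -` B) = emeasure (sphere_area R) B"
    if B: "B \<in> sets borel" for B
  proof -
    define C where "C = {x \<in> ball 0 R. (R / norm x) *\<^sub>R x \<in> B}"
    define D where "D = {x \<in> ball 0 R. (R / norm x) *\<^sub>R x \<in> f -` B}"
    have [measurable]: "B \<in> sets borel" by (rule B)
    have fB [measurable]: "f -` B \<in> sets borel"
      using measurable_sets[OF mf B] by simp
    have C: "C \<in> sets borel" and D: "D \<in> sets borel"
      unfolding C_def D_def by measurable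
    have lm: "S \<in> lmeasurable" if "S \<in> sets borel" "S \<subseteq> ball 0 R" for S :: "(real^3) set"
      using that by (intro bounded_set_imp_lmeasurable) (auto intro: bounded_subset[OF bounded_ball])
    have "C = f ` D"
    proof (intro set_eqI iffI)
      fix y assume y: "y \<in> C"
      obtain x where x: "y = f x"
        using orthogonal_transformation_surj[OF f] by auto
      have "x \<in> D" using y nf linear_scale[OF lin] by (auto simp: C_def D_def x)
      then show "y \<in> f ` D" by (simp add: x)
    next
      fix y assume "y \<in> f ` D"
      then show "y \<in> C" using nf linear_scale[OF lin] by (auto simp: C_def D_def)
    qed
    moreover have "C \<subseteq> ball 0 R" "D \<subseteq> ball 0 R"
      by (auto simp: C_def D_def)
    then have lmCD: "C \<in> lmeasurable" "D \<in> lmeasurable"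
      using C D lm by blast+
    ultimately have "measure lebesgue C = measure lebesgue D"
      using measure_orthogonal_image[OF f lmCD(2)] by metis
    moreover note lmCD
    ultimately have "emeasure lebesgue C = emeasure lebesgue D"
      by (simp add: emeasure_eq_measure2)
    then have "emeasure lborel C = emeasure lborel D"
      using C D by simp
    then show ?thesis
      using B fB by (simp add: emeasure_sphere_area C_def D_def)
  qed
  show ?thesis
  proof (rule measure_eqI)
    fix A assume "A \<in> sets (distr (uniform_sphere R) borel f)"
    then have A: "A \<in> sets borel" by simp
    have fA: "f -` A \<in> sets borel"
      using measurable_sets[OF mf A] by simp
    have *: "sphere 0 R \<inter> f -` A = f -` (sphere 0 R \<inter> A)"
      using nf by auto
    have "emeasure (distr (uniform_sphere R) borel f) A = emeasure (uniform_sphere R) (f -` A)"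
      using A by (subst emeasure_distr) auto
    also have "\<dots> = emeasure (uniform_sphere R) A"
      using A fA inv[of "sphere 0 R \<inter> A"] by (simp add: uniform_sphere_def *)
    finally show "emeasure (distr (uniform_sphere R) borel f) A = emeasure (uniform_sphere R) A" .
  qed simp
qed

end

theory Submission
  imports Defs
begin

text \<open>
  The part of the sphere within distance \<open>r\<close> of the user is a cap, and by Archimedes' theorem its
  share of the area is \<open>q r = (r\<^sup>2 - r_min\<^sup>2) / (4 r_earth (r_earth + r_min))\<close>. Area is
  defined through volumes of cones, so this amounts to the volume of a spherical cone, computed by
  slicing perpendicular to its axis. Only caps above the horizon matter, that is, cones of opening
  angle less than a right angle. By independence, the distance to the nearest satellite has
  distribution function \<open>1 - (1 - q r) ^ N\<close> up to \<open>r_max\<close>; dividing its derivative by the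
  probability of a link gives the density under the conditional measure. There the gain is
  independent of the distance, so the coverage probability is an integral against this density, in
  which the probability of a link cancels.
\<close>

section \<open>Coordinates on three-dimensional space\<close>

lemma measurable_vec3 [measurable]:
  "(\<lambda>(x, y, z). vector [x, y, z] :: real ^ 3) \<in> borel_measurable borel"
  by (intro borel_measurable_continuous_onI, subst continuous_on_componentwise)
     (auto simp: case_prod_beta forall_3 Basis_vec_def inner_axis intro!: continuous_intros)

text \<open>Lebesgue measure is determined by its values on boxes, and a box pulls back to a product
  of three intervals. This gives access to Fubini's theorem with the first coordinate split off from
  the other two.\<close>

lemma distr_lborel_vec3:
  "distr (lborel :: (real \<times> real \<times> real) measure) borel (\<lambda>(x, y, z). vector [x, y, z]) = (lborel :: (real ^ 3) measure)"
proof (rule lborel_eqI[symmetric])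
  let ?f = "\<lambda>(x, y, z). vector [x, y, z] :: real ^ 3"
  fix l u :: "real ^ 3"
  assume le: "\<And>b. b \<in> Basis \<Longrightarrow> l \<bullet> b \<le> u \<bullet> b"
  have le': "l $ i \<le> u $ i" for i
    using le[of "axis i 1"] by (simp add: inner_axis axis_in_Basis_iff)
  have box: "?f -` box l u = box (l $ 1, l $ 2, l $ 3) (u $ 1, u $ 2, u $ 3)"
    by (auto simp: mem_box_cart forall_3 mem_box Basis_prod_def)
  have "emeasure (distr lborel borel ?f) (box l u)
      = emeasure lborel (box (l $ 1, l $ 2, l $ 3) (u $ 1, u $ 2, u $ 3))"
    using box by (subst emeasure_distr) auto
  also have "\<dots> = ennreal ((u $ 1 - l $ 1) * ((u $ 2 - l $ 2) * (u $ 3 - l $ 3)))"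
    using le' by (auto simp: emeasure_lborel_box_eq Basis_prod_def mult_ac)
  also have "(u $ 1 - l $ 1) * ((u $ 2 - l $ 2) * (u $ 3 - l $ 3)) = (\<Prod>i\<in>UNIV. (u - l) $ i)"
    unfolding UNIV_3 by simp
  also have "\<dots> = (\<Prod>b\<in>range (\<lambda>i. axis i 1). (u - l) \<bullet> b)"
    by (subst prod.reindex) (auto simp: inj_on_def axis_eq_axis inner_axis)
  also have "range (\<lambda>i :: 3. axis i (1 :: real)) = Basis"
    by (auto simp: Basis_vec_def)
  finally show "emeasure (distr lborel borel ?f) (box l u) = (\<Prod>b\<in>Basis. (u - l) \<bullet> b)" .
qed simp

section \<open>Volume of a spherical cone\<close>

text \<open>Here \<open>t\<close> is the cosine of half the opening angle of a cone about the first
  axis. A nonempty slice at height \<open>x\<close> is a disc: up to height \<open>t * R\<close> the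
  cone bounds it, from there on the sphere does. At \<open>x = t * R\<close> both indicators are 1,
  so this single height, a null set, is left out.\<close>

lemma cone_slice:
  fixes R t x :: real
  assumes "R > 0" "0 < t" "t \<le> 1" "x \<noteq> t * R"
  shows "emeasure lborel {v :: real \<times> real. x\<^sup>2 + (norm v)\<^sup>2 < R\<^sup>2 \<and> t * sqrt (x\<^sup>2 + (norm v)\<^sup>2) \<le> x}
    = ennreal (pi * ((1 - t\<^sup>2) / t\<^sup>2) * x\<^sup>2) * indicator {0..t * R} x
    + ennreal (pi * (R\<^sup>2 - x\<^sup>2)) * indicator {t * R..R} x"
proof -
  let ?S = "{v :: real \<times> real. x\<^sup>2 + (norm v)\<^sup>2 < R\<^sup>2 \<and> t * sqrt (x\<^sup>2 + (norm v)\<^sup>2) \<le> x}"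
  have cone: "t * sqrt (x\<^sup>2 + s\<^sup>2) \<le> x \<longleftrightarrow> t\<^sup>2 * (x\<^sup>2 + s\<^sup>2) \<le> x\<^sup>2" if "x \<ge> 0" for s
    using that assms abs_le_square_iff[of "t * sqrt (x\<^sup>2 + s\<^sup>2)" x] by (simp add: power_mult_distrib)
  consider "x < 0" | "0 \<le> x" "x < t * R" | "t * R < x" "x < R" | "R \<le> x" "t * R < x"
    using assms by linarith
  then show ?thesis
  proof cases
    case 1
    have "?S = {}"
      using 1 assms by (auto simp: not_le intro: less_le_trans)
    then have "emeasure lborel ?S = 0" by (simp only: emeasure_empty)
    moreover have "\<not> t * R \<le> x" using 1 assms by (simp add: not_le less_trans[of x 0])
    ultimately show ?thesis using 1 by simp
  next
    case 2
    have tR: "x\<^sup>2 < t\<^sup>2 * R\<^sup>2"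
      using 2 assms by (metis power_mult_distrib power_strict_mono zero_less_numeral)
    \<comment> \<open>\<open>k\<close> is \<open>x\<close> times the tangent of the half-angle, the
      radius of the cone at height \<open>x\<close>.\<close>
    define k where "k = x * sqrt (1 - t\<^sup>2) / t"
    have t1: "t\<^sup>2 \<le> 1" using assms by (simp add: power_le_one)
    have k: "k \<ge> 0" "k\<^sup>2 = x\<^sup>2 * (1 - t\<^sup>2) / t\<^sup>2"
      using 2 assms t1 by (auto simp: k_def power_mult_distrib power_divide)
    have "?S = cball 0 k"
    proof (intro set_eqI)
      fix v :: "real \<times> real"
      have "v \<in> cball 0 k \<longleftrightarrow> (norm v)\<^sup>2 \<le> k\<^sup>2"
        using k(1) by (simp add: power2_le_iff_abs_le)
      also have "\<dots> \<longleftrightarrow> t\<^sup>2 * (x\<^sup>2 + (norm v)\<^sup>2) \<le> x\<^sup>2"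
        using assms by (simp add: k field_simps)
      also have "\<dots> \<longleftrightarrow> v \<in> ?S"
      proof -
        \<comment> \<open>Below height \<open>t * R\<close> the cone condition already forces the
          point into the ball.\<close>
        have "x\<^sup>2 + (norm v)\<^sup>2 < R\<^sup>2" if "t\<^sup>2 * (x\<^sup>2 + (norm v)\<^sup>2) \<le> x\<^sup>2"
        proof -
          have "t\<^sup>2 * (x\<^sup>2 + (norm v)\<^sup>2) < t\<^sup>2 * R\<^sup>2" using that tR by linarith
          then show ?thesis using assms by simp
        qed
        then show ?thesis using cone[of "norm v"] 2 by auto
      qed
      finally show "v \<in> ?S \<longleftrightarrow> v \<in> cball 0 k" ..
    qed
    then show ?thesis
      using 2 assms k by (simp add: emeasure_cball unit_ball_vol_2 power2_eq_square[of k, symmetric] mult_ac)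
  next
    case 3
    have tR: "t\<^sup>2 * R\<^sup>2 < x\<^sup>2"
      using 3 assms by (metis power_mult_distrib power_strict_mono zero_less_numeral mult_nonneg_nonneg less_imp_le)
    have x0: "0 < x" using 3 assms by (meson less_trans mult_pos_pos)
    have xR: "x\<^sup>2 < R\<^sup>2" using 3 x0 by (simp add: power_strict_mono)
    have "?S = ball 0 (sqrt (R\<^sup>2 - x\<^sup>2))"
    proof (intro set_eqI)
      fix v :: "real \<times> real"
      have "v \<in> ball 0 (sqrt (R\<^sup>2 - x\<^sup>2)) \<longleftrightarrow> x\<^sup>2 + (norm v)\<^sup>2 < R\<^sup>2"
        using real_sqrt_less_iff[of "(norm v)\<^sup>2" "R\<^sup>2 - x\<^sup>2"] by (auto simp del: real_sqrt_less_iff)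
      \<comment> \<open>Above height \<open>t * R\<close> it is the other way round: points of the
        ball at this height lie in the cone.\<close>
      moreover have "t\<^sup>2 * (x\<^sup>2 + (norm v)\<^sup>2) \<le> x\<^sup>2" if "x\<^sup>2 + (norm v)\<^sup>2 < R\<^sup>2"
      proof -
        have "t\<^sup>2 * (x\<^sup>2 + (norm v)\<^sup>2) \<le> t\<^sup>2 * R\<^sup>2" using that by (intro mult_left_mono) auto
        then show ?thesis using tR by linarith
      qed
      ultimately show "v \<in> ?S \<longleftrightarrow> v \<in> ball 0 (sqrt (R\<^sup>2 - x\<^sup>2))"
        using cone[of "norm v"] x0 by auto
    qed
    then show ?thesis
      using 3 x0 xR assms by (simp add: emeasure_ball unit_ball_vol_2)
  next
    case 4
    have x0: "0 < x" using 4 assms by linarith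
    have "R\<^sup>2 \<le> x\<^sup>2" using 4 assms by (simp add: power_mono)
    then have "?S = {}" by (auto simp: not_less intro: add_increasing2)
    then have "emeasure lborel ?S = 0" by (simp only: emeasure_empty)
    then show ?thesis using 4 by (auto simp: indicator_def)
  qed
qed

text \<open>Cavalieri's principle: the areas of the slices are integrated along the axis, in two
  pieces that meet at height \<open>t * R\<close>, each by an explicit antiderivative.\<close>

lemma emeasure_cone:
  fixes R t :: real
  assumes R: "R > 0" and t: "0 < t" "t \<le> 1"
  shows "emeasure lborel {x \<in> ball (0 :: real ^ 3) R. t * norm x \<le> x $ 1} = ennreal (2 * pi / 3 * (1 - t) * R ^ 3)"
proof -
  let ?f = "\<lambda>(x, y, z). vector [x, y, z] :: real ^ 3"
  let ?A = "{x \<in> ball (0 :: real ^ 3) R. t * norm x \<le> x $ 1}"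
  let ?S = "\<lambda>x. {v :: real \<times> real. x\<^sup>2 + (norm v)\<^sup>2 < R\<^sup>2 \<and> t * sqrt (x\<^sup>2 + (norm v)\<^sup>2) \<le> x}"
  let ?K = "{q :: real \<times> real \<times> real. (fst q)\<^sup>2 + (norm (snd q))\<^sup>2 < R\<^sup>2 \<and> t * sqrt ((fst q)\<^sup>2 + (norm (snd q))\<^sup>2) \<le> fst q}"
  define c where "c = pi * ((1 - t\<^sup>2) / t\<^sup>2)"
  have c: "c \<ge> 0" using t by (simp add: c_def power_le_one)
  have A: "?A \<in> sets borel" by measurable
  have nf: "norm (?f q) = sqrt ((fst q)\<^sup>2 + (norm (snd q))\<^sup>2)" for q
    by (cases q) (simp add: norm_vec_def L2_set_def sum_3 norm_prod_def)
  have pre: "?f -` ?A = ?K"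
    using R by (auto simp: nf real_sqrt_less_iff[of _ "R\<^sup>2", symmetric] simp del: real_sqrt_less_iff)
  have K: "?K \<in> sets borel"
    using measurable_sets[OF measurable_vec3 A] unfolding pre by simp
  have "emeasure lborel ?A = emeasure lborel (?f -` ?A)"
    using A by (subst distr_lborel_vec3[symmetric], subst emeasure_distr) auto
  also have "\<dots> = emeasure (lborel \<Otimes>\<^sub>M lborel) ?K"
    by (simp only: pre lborel_prod)
  also have "\<dots> = (\<integral>\<^sup>+ x. emeasure lborel (Pair x -` ?K) \<partial>lborel)"
    using K by (intro lborel.emeasure_pair_measure_alt) (simp only: lborel_prod sets_lborel)
  also have "\<dots> = (\<integral>\<^sup>+ x. (ennreal (c * x\<^sup>2) * indicator {0..t * R} x
    + ennreal (pi * (R\<^sup>2 - x\<^sup>2)) * indicator {t * R..R} x) \<partial>lborel)"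
  proof (rule nn_integral_cong_AE)
    have "AE x in lborel. x \<noteq> t * R" by (rule AE_lborel_singleton)
    then show "AE x in lborel. emeasure lborel (Pair x -` ?K) = (ennreal (c * x\<^sup>2) * indicator {0..t * R} x
    + ennreal (pi * (R\<^sup>2 - x\<^sup>2)) * indicator {t * R..R} x)"
      by eventually_elim (use cone_slice[OF assms] in \<open>simp add: c_def\<close>)
  qed
  also have "\<dots> = (\<integral>\<^sup>+ x. ennreal (c * x\<^sup>2) * indicator {0..t * R} x \<partial>lborel)
    + (\<integral>\<^sup>+ x. ennreal (pi * (R\<^sup>2 - x\<^sup>2)) * indicator {t * R..R} x \<partial>lborel)"
    by (rule nn_integral_add) auto
  also have "(\<integral>\<^sup>+ x. ennreal (c * x\<^sup>2) * indicator {0..t * R} x \<partial>lborel)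
    = ennreal (c * (t * R) ^ 3 / 3 - c * 0 ^ 3 / 3)"
    using assms c by (intro nn_integral_FTC_Icc) (auto intro!: derivative_eq_intros)
  also have "(\<integral>\<^sup>+ x. ennreal (pi * (R\<^sup>2 - x\<^sup>2)) * indicator {t * R..R} x \<partial>lborel)
    = ennreal (pi * (R\<^sup>2 * R - R ^ 3 / 3) - pi * (R\<^sup>2 * (t * R) - (t * R) ^ 3 / 3))"
  proof (intro nn_integral_FTC_Icc)
    fix x assume x: "x \<in> {t * R..R}"
    moreover have "0 \<le> t * R" using R t by simp
    ultimately have "0 \<le> x" by simp
    then show "0 \<le> pi * (R\<^sup>2 - x\<^sup>2)" using x by (simp add: power_mono)
  qed (use R t in \<open>auto intro!: derivative_eq_intros\<close>)
  also have "ennreal (c * (t * R) ^ 3 / 3 - c * 0 ^ 3 / 3) + \<dots>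
     = ennreal (c * (t * R) ^ 3 / 3 + (pi * (R\<^sup>2 * R - R ^ 3 / 3) - pi * (R\<^sup>2 * (t * R) - (t * R) ^ 3 / 3)))"
  proof (subst ennreal_plus)
    \<comment> \<open>This is the volume of the cap of the ball beyond height \<open>t * R\<close>;
      the factorization shows that it is nonnegative, as merging the two \<open>ennreal\<close>
      summands requires.\<close>
    have "pi * (R\<^sup>2 * R - R ^ 3 / 3) - pi * (R\<^sup>2 * (t * R) - (t * R) ^ 3 / 3)
        = pi * R ^ 3 / 3 * ((1 - t)\<^sup>2 * (2 + t))"
      by (simp add: algebra_simps power2_eq_square power3_eq_cube)
    also have "\<dots> \<ge> 0" using R t by (intro mult_nonneg_nonneg) auto
    finally show "0 \<le> pi * (R\<^sup>2 * R - R ^ 3 / 3) - pi * (R\<^sup>2 * (t * R) - (t * R) ^ 3 / 3)" .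
  qed (use R t c in auto)
  also have "c * (t * R) ^ 3 / 3 + (pi * (R\<^sup>2 * R - R ^ 3 / 3) - pi * (R\<^sup>2 * (t * R) - (t * R) ^ 3 / 3))
    = 2 * pi / 3 * (1 - t) * R ^ 3"
    using t by (simp add: c_def field_simps power2_eq_square power3_eq_cube)
  finally show ?thesis .
qed

section \<open>Area of spherical caps\<close>

text \<open>An orthogonal map moves the axis of the cap to the first coordinate axis. The cone over
  the cap is then that of \<open>emeasure_cone\<close>, up to its apex, and dividing the resulting
  area by that of the sphere leaves a quantity linear in the height.\<close>

lemma measure_uniform_sphere_cap:
  fixes u :: "real ^ 3"
  assumes R: "R > 0" and t: "0 < t" "t \<le> 1" and u: "u \<noteq> 0"
  shows "measure (uniform_sphere R) {x. t * R * norm u \<le> u \<bullet> x} = (1 - t) / 2"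
proof -
  let ?e = "axis 1 1 :: real ^ 3"
  obtain f where f: "orthogonal_transformation f" and fe: "f (norm u *\<^sub>R ?e) = u"
    using orthogonal_transformation_exists[of "norm u *\<^sub>R ?e" u] by auto
  have lin: "linear f" using f by (simp add: orthogonal_transformation)
  have mf [measurable]: "f \<in> borel_measurable borel"
    by (intro borel_measurable_continuous_onI linear_continuous_on
          linear_conv_bounded_linear[THEN iffD1] lin)
  have uf: "u \<bullet> f x = norm u * x $ 1" for x
  proof -
    \<comment> \<open>\<open>f\<close> preserves inner products, and \<open>u\<close> is the image
      of \<open>norm u *\<^sub>R ?e\<close>.\<close>
    have "u \<bullet> f x = (norm u *\<^sub>R ?e) \<bullet> x"
      using f fe unfolding orthogonal_transformation_def by metis
    then show ?thesis by (simp add: inner_axis')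
  qed
  let ?B = "{x :: real ^ 3. t * R \<le> x $ 1}"
  have B: "?B \<in> sets borel" by measurable
  have "measure (uniform_sphere R) {x. t * R * norm u \<le> u \<bullet> x}
      = measure (distr (uniform_sphere R) borel f) {x. t * R * norm u \<le> u \<bullet> x}"
    by (simp only: uniform_sphere_orthogonal_invariant[OF f])
  also have "\<dots> = measure (uniform_sphere R) (f -` {x. t * R * norm u \<le> u \<bullet> x} \<inter> space (uniform_sphere R))"
    by (rule measure_distr) (auto, measurable)
  also have "f -` {x. t * R * norm u \<le> u \<bullet> x} \<inter> space (uniform_sphere R) = ?B"
    using u by (auto simp: uf mult.commute)
  also have "measure (uniform_sphere R) ?B
      = measure (sphere_area R) (sphere 0 R \<inter> ?B) / measure (sphere_area R) (sphere 0 R)"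
    unfolding uniform_sphere_def using R B
    by (intro measure_uniform_measure) (auto simp: sphere_area_total)
  also have "measure (sphere_area R) (sphere 0 R) = 4 * pi * R\<^sup>2"
    using R by (simp add: measure_def sphere_area_total)
  also have "emeasure (sphere_area R) (sphere 0 R \<inter> ?B) = ennreal (2 * pi * (1 - t) * R\<^sup>2)"
  proof -
    \<comment> \<open>The apex differs: division by zero yields 0, so the radial projection sends
      the origin to itself, off the sphere, whereas \<open>t * norm x \<le> x $ 1\<close> holds
      there.\<close>
    have "{x \<in> ball 0 R. (R / norm x) *\<^sub>R x \<in> sphere 0 R \<inter> ?B}
      = {x \<in> ball (0 :: real ^ 3) R. t * norm x \<le> x $ 1} - {0}"
      using R by (auto simp: field_simps)
    then have "emeasure (sphere_area R) (sphere 0 R \<inter> ?B)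
      = ennreal (3 / R) * emeasure lborel ({x \<in> ball (0 :: real ^ 3) R. t * norm x \<le> x $ 1} - {0})"
      using B by (subst emeasure_sphere_area) auto
    also have "emeasure lborel ({x \<in> ball (0 :: real ^ 3) R. t * norm x \<le> x $ 1} - {0})
      = emeasure lborel {x \<in> ball (0 :: real ^ 3) R. t * norm x \<le> x $ 1}"
      by (rule emeasure_Diff_null_set) auto
    also have "ennreal (3 / R) * \<dots> = ennreal (3 / R * (2 * pi / 3 * (1 - t) * R ^ 3))"
      unfolding emeasure_cone[OF R t] by (rule ennreal_mult[symmetric]) (use R t in auto)
    also have "3 / R * (2 * pi / 3 * (1 - t) * R ^ 3) = 2 * pi * (1 - t) * R\<^sup>2"
      using R by (simp add: power2_eq_square power3_eq_cube)
    finally show ?thesis .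
  qed
  then have "measure (sphere_area R) (sphere 0 R \<inter> ?B) = 2 * pi * (1 - t) * R\<^sup>2"
    using t by (simp add: measure_def)
  also have "2 * pi * (1 - t) * R\<^sup>2 / (4 * pi * R\<^sup>2) = (1 - t) / 2"
    using R by simp
  finally show ?thesis .
qed

text \<open>The law of cosines turns a bound on the distance from \<open>u\<close> into a lower
  bound on \<open>u \<bullet> x\<close>, so the ball cuts out a cap. The upper bound on
  \<open>r\<^sup>2\<close> keeps this cap smaller than a hemisphere; \<open>h \<le> r\<close> makes
  it nonempty.\<close>

lemma measure_uniform_sphere_cball:
  fixes u :: "real ^ 3"
  assumes u: "norm u = a" "a > 0" and h: "h \<ge> 0" and r: "h \<le> r" "r\<^sup>2 < a\<^sup>2 + (a + h)\<^sup>2"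
  shows "measure (uniform_sphere (a + h)) (cball u r) = (r\<^sup>2 - h\<^sup>2) / (4 * a * (a + h))"
proof -
  \<comment> \<open>The cosine of the angle at the center of Earth between \<open>u\<close> and a
    point of the orbit sphere at distance \<open>r\<close> from \<open>u\<close>.\<close>
  define t where "t = (a\<^sup>2 + (a + h)\<^sup>2 - r\<^sup>2) / (2 * a * (a + h))"
  have p: "2 * a * (a + h) > 0" using u h by simp
  have t1: "1 - t = (r\<^sup>2 - h\<^sup>2) / (2 * a * (a + h))"
  proof -
    have "1 - t = (2 * a * (a + h) - (a\<^sup>2 + (a + h)\<^sup>2 - r\<^sup>2)) / (2 * a * (a + h))"
      using u h by (simp add: t_def diff_divide_distrib)
    also have "2 * a * (a + h) - (a\<^sup>2 + (a + h)\<^sup>2 - r\<^sup>2) = r\<^sup>2 - h\<^sup>2"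
      by (simp add: power2_eq_square algebra_simps)
    finally show ?thesis .
  qed
  have "h\<^sup>2 \<le> r\<^sup>2" using h r by (simp add: power_mono)
  then have "1 - t \<ge> 0" unfolding t1 using p by (intro divide_nonneg_pos) auto
  moreover have "t > 0" unfolding t_def using p r by (intro divide_pos_pos) auto
  ultimately have t: "0 < t" "t \<le> 1" by auto
  \<comment> \<open>The measure lives on the whole space, so \<open>norm x = a + h\<close> is
    available only almost everywhere.\<close>
  have AE: "AE x in uniform_sphere (a + h). x \<in> sphere 0 (a + h)"
    unfolding uniform_sphere_def by (rule AE_uniform_measureI) auto
  have "(dist u x \<le> r) = (t * (a + h) * norm u \<le> u \<bullet> x)" if "norm x = a + h" for x
  proof -
    have "(dist u x \<le> r) = ((dist u x)\<^sup>2 \<le> r\<^sup>2)"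
      using h r by (simp add: power2_le_iff_abs_le)
    also have "(dist u x)\<^sup>2 = (norm u)\<^sup>2 + (norm x)\<^sup>2 - 2 * (u \<bullet> x)"
      by (simp add: dist_norm power2_norm_eq_inner inner_diff inner_commute)
    also have "\<dots> = a\<^sup>2 + (a + h)\<^sup>2 - 2 * (u \<bullet> x)"
      by (simp only: u(1) that)
    also have "(\<dots> \<le> r\<^sup>2) = (a\<^sup>2 + (a + h)\<^sup>2 - r\<^sup>2 \<le> 2 * (u \<bullet> x))" by auto
    also have "a\<^sup>2 + (a + h)\<^sup>2 - r\<^sup>2 = 2 * (t * (a + h) * norm u)"
      using u h by (simp add: t_def)
    finally show ?thesis by simp
  qed
  then have "AE x in uniform_sphere (a + h). x \<in> cball u r \<longleftrightarrow> x \<in> {x. t * (a + h) * norm u \<le> u \<bullet> x}"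
    using AE by (auto elim: eventually_mono)
  moreover have "{x. t * (a + h) * norm u \<le> u \<bullet> x} \<in> sets borel" by measurable
  ultimately have "measure (uniform_sphere (a + h)) (cball u r)
      = measure (uniform_sphere (a + h)) {x. t * (a + h) * norm u \<le> u \<bullet> x}"
    by (intro measure_eq_AE) simp_all
  also have "\<dots> = (1 - t) / 2"
  proof (rule measure_uniform_sphere_cap)
    show "a + h > 0" "u \<noteq> 0" using u h by auto
  qed (fact t)+
  also have "\<dots> = (r\<^sup>2 - h\<^sup>2) / (4 * a * (a + h))"
    unfolding t1 by simp
  finally show ?thesis .
qed

section \<open>Distance to the nearest satellite\<close>

text \<open>The minimum over finitely many satellites is attained, whichever tie
  \<open>arg_min_on\<close> picks; over an empty set the pick would be arbitrary. From here on the
  serving distance is handled only through this equivalence.\<close>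

lemma serving_distance_le_iff:
  assumes "N \<ge> 1"
  shows "serving_distance N X u \<omega> \<le> r \<longleftrightarrow> (\<exists>i<N. dist u (X i \<omega>) \<le> r)"
proof -
  let ?d = "\<lambda>i. dist u (X i \<omega>)"
  have ne: "{..<N} \<noteq> {}" using assms by (auto simp: lessThan_empty_iff)
  have "serving_satellite N X u \<omega> < N"
    using arg_min_if_finite(1)[of "{..<N}" ?d] ne by (simp add: serving_satellite_def)
  moreover have "serving_distance N X u \<omega> \<le> ?d i" if "i < N" for i
    using arg_min_least[of "{..<N}" i ?d] ne that
    by (simp add: serving_distance_def serving_satellite_def)
  ultimately show ?thesis
    unfolding serving_distance_def by (meson order_trans)
qed

context prob_space
begin

text \<open>Sublevel sets are finite unions of events about single satellites; this sidesteps the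
  measurability of the selected index.\<close>

lemma measurable_serving_distance:
  assumes "N \<ge> 1" and X: "\<And>i. i < N \<Longrightarrow> X i \<in> borel_measurable M"
  shows "serving_distance N X u \<in> borel_measurable M"
proof (rule borel_measurable_iff_le[THEN iffD2], rule allI)
  fix r
  have "{w \<in> space M. serving_distance N X u w \<le> r} = (\<Union>i\<in>{..<N}. {w \<in> space M. dist u (X i w) \<le> r})"
    using assms by (auto simp: serving_distance_le_iff)
  also have "\<dots> \<in> sets M"
    using X by (intro sets.finite_UN) auto
  finally show "{w \<in> space M. serving_distance N X u w \<le> r} \<in> sets M" .
qed

text \<open>The nearest satellite is farther than \<open>r\<close> exactly when all are; by
  independence the probability of this is the \<open>N\<close>-th power of the share of the sphere
  outside the cap.\<close>

lemma prob_serving_distance_le: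
  assumes N: "N \<ge> 1" and a: "a > 0" "h \<ge> 0" and u: "norm u = a"
    and indep: "indep_vars (\<lambda>_. borel) X {..<N}"
    and unif: "\<And>i. i < N \<Longrightarrow> distr M borel (X i) = uniform_sphere (a + h)"
    and r: "h \<le> r" "r\<^sup>2 < a\<^sup>2 + (a + h)\<^sup>2"
  shows "prob {\<omega> \<in> space M. serving_distance N X u \<omega> \<le> r} = 1 - (1 - (r\<^sup>2 - h\<^sup>2) / (4 * a * (a + h))) ^ N"
proof -
  have X: "X i \<in> borel_measurable M" if "i < N" for i
    using indep that by (auto simp: indep_vars_def)
  note mR = measurable_serving_distance[OF N X, measurable]
  have far: "prob (X i -` (- cball u r) \<inter> space M) = 1 - (r\<^sup>2 - h\<^sup>2) / (4 * a * (a + h))" if i: "i < N" for i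
  proof -
    interpret S: prob_space "uniform_sphere (a + h)"
      using a by (intro prob_space_uniform_sphere) simp
    have "prob (X i -` (- cball u r) \<inter> space M) = measure (distr M borel (X i)) (- cball u r)"
      using X[OF i] by (simp add: measure_distr)
    also have "\<dots> = 1 - measure (uniform_sphere (a + h)) (cball u r)"
      using S.prob_compl[of "cball u r"] by (simp add: unif[OF i] Compl_eq_Diff_UNIV)
    finally show ?thesis
      using measure_uniform_sphere_cball[OF u a r] by simp
  qed
  have "prob {\<omega> \<in> space M. serving_distance N X u \<omega> \<le> r}
     = 1 - prob {\<omega> \<in> space M. \<not> serving_distance N X u \<omega> \<le> r}"
    by (subst prob_neg) auto
  also have "{\<omega> \<in> space M. \<not> serving_distance N X u \<omega> \<le> r} = (\<Inter>i\<in>{..<N}. X i -` (- cball u r) \<inter> space M)"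
    using N by (auto simp: serving_distance_le_iff lessThan_empty_iff)
  also have "prob \<dots> = (\<Prod>i\<in>{..<N}. prob (X i -` (- cball u r) \<inter> space M))"
    using N by (intro indep_varsD_finite[OF indep]) (auto simp: lessThan_empty_iff)
  finally show ?thesis by (simp add: far)
qed

end

section \<open>Conditional density and independent thresholds\<close>

context prob_space
begin

text \<open>Distribution functions determine the laws: from \<open>h\<close> on, each is
  \<open>F (min x b) / F b\<close>, by conditioning on one side and by the fundamental theorem of
  calculus on the other.\<close>

lemma distr_uniform_measure_le_eq_density:
  fixes X F f :: "_ \<Rightarrow> real"
  assumes X [measurable]: "X \<in> borel_measurable M"
    and [measurable]: "f \<in> borel_measurable borel"
    and hb: "h \<le> b" and F: "\<And>x. h \<le> x \<Longrightarrow> x \<le> b \<Longrightarrow> prob {\<omega> \<in> space M. X \<omega> \<le> x} = F x"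
    and F0: "F h = 0" and Fb: "F b > 0"
    and f: "\<And>x. h \<le> x \<Longrightarrow> x \<le> b \<Longrightarrow> (F has_real_derivative f x) (at x)"
    and f0: "\<And>x. h \<le> x \<Longrightarrow> x \<le> b \<Longrightarrow> 0 \<le> f x"
  shows "distr (uniform_measure M {\<omega> \<in> space M. X \<omega> \<le> b}) borel X
    = density lborel (\<lambda>x. ennreal (f x / F b * indicator {h..b} x))" (is "?L = ?D")
proof (rule cdf_unique)
  let ?A = "{\<omega> \<in> space M. X \<omega> \<le> b}"
  have A: "prob ?A = F b" using F hb by simp
  have A': "emeasure M ?A \<noteq> 0" "emeasure M ?A \<noteq> \<infinity>"
    using A Fb by (auto simp: emeasure_eq_measure)
  interpret U: prob_space "uniform_measure M ?A"
    by (rule prob_space_uniform_measure[OF A'])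
  show "real_distribution ?L"
    by (rule U.real_distribution_distr) simp
  have D: "emeasure ?D {..x} = ennreal (F (min x b) / F b)" if "h \<le> x" for x
  proof -
    have "emeasure ?D {..x} = (\<integral>\<^sup>+ y. ennreal (f y / F b) * indicator {h..min x b} y \<partial>lborel)"
      by (subst emeasure_density) (auto intro!: nn_integral_cong split: split_indicator)
    also have "\<dots> = ennreal (F (min x b) / F b - F h / F b)"
      using that hb f f0 Fb by (intro nn_integral_FTC_Icc DERIV_cdivide) auto
    finally show ?thesis by (simp add: F0)
  qed
  have "emeasure ?D (space ?D) = (\<integral>\<^sup>+ y. ennreal (f y / F b) * indicator {h..b} y \<partial>lborel)"
    by (subst emeasure_density) (auto intro!: nn_integral_cong split: split_indicator)
  also have "\<dots> = emeasure ?D {..b}"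
    by (subst emeasure_density) (auto intro!: nn_integral_cong split: split_indicator)
  also have "\<dots> = 1" using D[OF hb] Fb by simp
  finally interpret D: prob_space ?D by (rule prob_spaceI)
  show "real_distribution ?D"
    by unfold_locales simp
  show "cdf ?L = cdf ?D"
  proof
    fix x
    have "cdf ?L x = measure (uniform_measure M ?A) {\<omega> \<in> space M. X \<omega> \<le> x}"
      unfolding cdf_def by (subst measure_distr) (auto intro!: arg_cong2[where f = measure])
    also have "\<dots> = prob (?A \<inter> {\<omega> \<in> space M. X \<omega> \<le> x}) / F b"
      using A A' by (subst measure_uniform_measure) auto
    also have "?A \<inter> {\<omega> \<in> space M. X \<omega> \<le> x} = {\<omega> \<in> space M. X \<omega> \<le> min x b}"
      by auto
    finally have L: "cdf ?L x = prob {\<omega> \<in> space M. X \<omega> \<le> min x b} / F b" .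
    show "cdf ?L x = cdf ?D x"
    proof (cases "h \<le> x")
      case True
      then have "F (min x b) \<ge> 0" using F[of "min x b"] hb by (metis measure_nonneg min.boundedI min.cobounded2)
      then show ?thesis
        using F[of "min x b"] D[OF True] L True hb Fb by (simp add: cdf_def measure_def)
    next
      case False
      \<comment> \<open>\<open>F\<close> describes the law only from \<open>h\<close> on; below,
        monotonicity and \<open>F h = 0\<close> force both sides to 0.\<close>
      have "prob {\<omega> \<in> space M. X \<omega> \<le> min x b} \<le> prob {\<omega> \<in> space M. X \<omega> \<le> h}"
        using False by (intro finite_measure_mono) auto
      then have "cdf ?L x = 0"
        using F[of h] hb F0 L by (simp add: measure_le_0_iff)
      moreover have "emeasure ?D {..x} \<le> emeasure ?D {..h}"
        using False by (intro emeasure_mono) auto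
      then have "cdf ?D x = 0" using D[of h] hb F0 by (simp add: cdf_def measure_def)
      ultimately show ?thesis by simp
    qed
  qed
qed

text \<open>Independence makes the joint law a product, so by Tonelli's theorem the value of
  \<open>R\<close> can be fixed first and the tail probability of \<open>G\<close> then averaged
  over the density of \<open>R\<close>.\<close>

lemma prob_indep_var_greater:
  fixes G R \<phi> g :: "_ \<Rightarrow> real"
  assumes indep: "indep_var borel G borel R"
    and [measurable]: "\<phi> \<in> borel_measurable borel" "g \<in> borel_measurable borel"
    and g: "\<And>r. 0 \<le> g r" and R: "distr M borel R = density lborel (\<lambda>r. ennreal (g r))"
  shows "prob {\<omega> \<in> space M. \<phi> (R \<omega>) < G \<omega>}
    = (\<integral>r. g r * (1 - cdf (distr M borel G) (\<phi> r)) \<partial>lborel)"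
proof -
  have [measurable]: "G \<in> borel_measurable M" "R \<in> borel_measurable M"
    using indep by (auto dest: indep_var_rv1 indep_var_rv2)
  let ?G = "distr M borel G" and ?R = "distr M borel R"
  interpret G: real_distribution ?G by (rule real_distribution_distr) simp
  interpret R: real_distribution ?R by (rule real_distribution_distr) simp
  interpret GR: pair_sigma_finite ?G ?R ..
  have [measurable]: "cdf ?G \<in> borel_measurable borel"
    by (intro borel_measurable_mono monoI G.cdf_nondecreasing)
  have le1: "cdf ?G x \<le> 1" for x by (rule G.cdf_bounded_prob)
  let ?Q = "{q :: real \<times> real. \<phi> (snd q) < fst q}"
  have Q: "?Q \<in> sets (borel \<Otimes>\<^sub>M borel)"
  proof -
    have "Measurable.pred (borel \<Otimes>\<^sub>M borel) (\<lambda>q. \<phi> (snd q) < fst q)" by measurable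
    then show ?thesis by (simp add: pred_def space_pair_measure)
  qed
  have "emeasure M {\<omega> \<in> space M. \<phi> (R \<omega>) < G \<omega>} = emeasure (distr M (borel \<Otimes>\<^sub>M borel) (\<lambda>\<omega>. (G \<omega>, R \<omega>))) ?Q"
    using Q by (subst emeasure_distr) (auto intro!: arg_cong2[where f = emeasure])
  also have "\<dots> = emeasure (?G \<Otimes>\<^sub>M ?R) ?Q"
    using indep by (simp add: indep_var_distribution_eq)
  also have "\<dots> = (\<integral>\<^sup>+ r. emeasure ?G ((\<lambda>x. (x, r)) -` ?Q) \<partial>?R)"
    using Q by (intro GR.emeasure_pair_measure_alt2) (simp cong: sets_pair_measure_cong)
  also have "\<dots> = (\<integral>\<^sup>+ r. ennreal (1 - cdf ?G (\<phi> r)) \<partial>?R)"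
  proof (rule nn_integral_cong)
    fix r
    \<comment> \<open>The strict inequality fits \<open>cdf\<close>, which counts the endpoint: the
      event is the complement of a closed half-line.\<close>
    have "(\<lambda>x. (x, r)) -` ?Q = space ?G - {..\<phi> r}" by auto
    then have "emeasure ?G ((\<lambda>x. (x, r)) -` ?Q) = ennreal (G.prob (space ?G - {..\<phi> r}))"
      by (simp only: G.emeasure_eq_measure)
    also have "G.prob (space ?G - {..\<phi> r}) = 1 - cdf ?G (\<phi> r)"
      unfolding cdf_def by (rule G.prob_compl) simp
    finally show "emeasure ?G ((\<lambda>x. (x, r)) -` ?Q) = ennreal (1 - cdf ?G (\<phi> r))" .
  qed
  also have "\<dots> = (\<integral>\<^sup>+ r. ennreal (g r) * ennreal (1 - cdf ?G (\<phi> r)) \<partial>lborel)"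
    unfolding R by (rule nn_integral_density) auto
  also have "\<dots> = (\<integral>\<^sup>+ r. ennreal (g r * (1 - cdf ?G (\<phi> r))) \<partial>lborel)"
    using g le1 by (simp add: ennreal_mult)
  finally have "emeasure M {\<omega> \<in> space M. \<phi> (R \<omega>) < G \<omega>} = \<dots>" .
  then show ?thesis
    using g le1 by (subst integral_eq_nn_integral) (auto simp: measure_def)
qed

end

section \<open>Range of the link and the SNR event\<close>

text \<open>The second bound says that satellites in range are never below the horizon.\<close>

lemma max_distance_bounds:
  assumes a: "a > 0" and h: "h > 0" and \<theta>: "0 \<le> \<theta>" "\<theta> \<le> pi / 2"
  shows "h \<le> max_distance a h \<theta>" "(max_distance a h \<theta>)\<^sup>2 \<le> (a + h)\<^sup>2 - a\<^sup>2"
proof -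
  define x where "x = h / a"
  define s where "s = sin \<theta>"
  define S where "S = sqrt (x * (x + 2) + s\<^sup>2)"
  have x: "x > 0" "a * x = h" using a h by (auto simp: x_def)
  have s: "0 \<le> s" "s \<le> 1" using \<theta> by (auto simp: s_def intro!: sin_ge_zero)
  have m: "max_distance a h \<theta> = a * (S - s)"
    by (simp add: max_distance_def x_def s_def S_def)
  have S: "S\<^sup>2 = x * (x + 2) + s\<^sup>2" using x by (simp add: S_def)
  have "x * s \<le> x" using x s by (simp add: mult_left_le)
  \<comment> \<open>Squared, this amounts to \<open>2 * x * s \<le> 2 * x\<close>, so it rests on
    the sine being at most 1.\<close>
  then have le: "x + s \<le> S"
    unfolding S_def by (intro real_le_rsqrt) (simp add: power2_eq_square algebra_simps)
  then show "h \<le> max_distance a h \<theta>"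
    using a mult_left_mono[of x "S - s" a] by (simp add: m x(2))
  \<comment> \<open>Expanding \<open>(S - s)\<^sup>2\<close> gives
    \<open>x * (x + 2) + 2 * s * (s - S)\<close>, and \<open>s \<le> S\<close>. Scaled by
    \<open>a\<^sup>2\<close>, the bound \<open>x * (x + 2)\<close> is the squared length of a
    tangent from the orbit to Earth.\<close>
  have "s * s \<le> s * S" using le x s by (intro mult_left_mono) auto
  then have "(S - s)\<^sup>2 \<le> x * (x + 2)"
    using S by (simp add: power2_eq_square algebra_simps)
  then have "a\<^sup>2 * (S - s)\<^sup>2 \<le> a\<^sup>2 * (x * (x + 2))" by (intro mult_left_mono) auto
  also have "\<dots> = (a + a * x)\<^sup>2 - a\<^sup>2"
    by (simp add: power2_eq_square algebra_simps)
  finally show "(max_distance a h \<theta>)\<^sup>2 \<le> (a + h)\<^sup>2 - a\<^sup>2"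
    by (simp add: m power_mult_distrib x(2))
qed

text \<open>\<open>T > 0\<close> rules out the out-of-range value 0, and \<open>r > 0\<close> makes
  \<open>r powr \<alpha>\<close> positive, so the path loss can be moved across the
  inequality.\<close>

lemma snr_greater_iff:
  assumes "p > 0" "\<sigma> > 0" "T > 0" "r > 0"
  shows "T < snr p \<sigma> \<alpha> r_max g r \<longleftrightarrow> r \<le> r_max \<and> T * r powr \<alpha> * \<sigma>\<^sup>2 / p < g"
proof -
  have "T < p * g * r powr (- \<alpha>) / \<sigma>\<^sup>2 \<longleftrightarrow> T * r powr \<alpha> * \<sigma>\<^sup>2 / p < g"
    using assms by (simp add: powr_minus field_simps)
  then show ?thesis using assms by (simp add: snr_def)
qed

section \<open>Coverage probability of the user\<close>

text \<open>Independence of gain and distance is stated under \<open>given_link\<close>: under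
  \<open>M\<close>, the convention that the gain is 0 out of range would tie the two
  together.\<close>

theorem proposition1:
  fixes M :: "'w measure"
    and N :: nat
    and X :: "nat \<Rightarrow> 'w \<Rightarrow> real ^ 3"
    and u :: "real ^ 3"
    and G\<^sub>0 R\<^sub>0 :: "'w \<Rightarrow> real"
    and r_earth r_min r_max \<theta>_min p \<sigma> \<alpha> T :: real
  assumes "prob_space M"
    and "N \<ge> 1" and "r_earth > 0" and "r_min > 0"
    and "0 \<le> \<theta>_min" and "\<theta>_min \<le> pi / 2"
    and "p > 0" and "\<sigma> > 0" and "T > 0"
    and r_max: "r_max = max_distance r_earth r_min \<theta>_min"
    and user: "u \<in> sphere 0 r_earth"
    and satellites_indep: "prob_space.indep_vars M (\<lambda>_. borel) X {..<N}"
    and satellites_uniform: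
      "\<And>i. i < N \<Longrightarrow> distr M borel (X i) = uniform_sphere (r_earth + r_min)"
    and R\<^sub>0: "R\<^sub>0 = serving_distance N X u"
    and gain_measurable: "G\<^sub>0 \<in> borel_measurable M"
    and gain_out_of_range: "\<And>\<omega>. \<omega> \<in> space M \<Longrightarrow> R\<^sub>0 \<omega> > r_max \<Longrightarrow> G\<^sub>0 \<omega> = 0"
    and gain_indep: "prob_space.indep_var (given_link M R\<^sub>0 r_max) borel G\<^sub>0 borel R\<^sub>0"
  shows "\<P>(\<omega> in M. snr p \<sigma> \<alpha> r_max (G\<^sub>0 \<omega>) (R\<^sub>0 \<omega>) > T) =
    real N / (2 * r_earth * (r_earth + r_min)) *
    (LBINT r:{r_min..r_max}.
      (1 - link_gain_cdf M R\<^sub>0 r_max G\<^sub>0 (T * r powr \<alpha> * \<sigma>\<^sup>2 / p)) *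
      (1 - (r\<^sup>2 - r_min\<^sup>2) / (4 * r_earth * (r_earth + r_min))) ^ (N - 1) * r)"
proof -
  interpret prob_space M by fact
  \<comment> \<open>For distances in range, \<open>q\<close> is the share of the cap,
    \<open>F\<close> the distribution function of \<open>R\<^sub>0\<close>, \<open>f\<close> its
    derivative, and \<open>\<phi> r\<close> the gain that a link of length \<open>r\<close> must
    exceed.\<close>
  define q where "q r = (r\<^sup>2 - r_min\<^sup>2) / (4 * r_earth * (r_earth + r_min))" for r
  define F where "F r = 1 - (1 - q r) ^ N" for r
  define c where "c = real N / (2 * r_earth * (r_earth + r_min))"
  define f where "f r = c * (1 - q r) ^ (N - 1) * r" for r
  define \<phi> where "\<phi> r = T * r powr \<alpha> * \<sigma>\<^sup>2 / p" for r
  let ?A = "{\<omega> \<in> space M. R\<^sub>0 \<omega> \<le> r_max}"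
  note pos = \<open>r_earth > 0\<close> \<open>r_min > 0\<close>
  have r_max_ge: "r_min \<le> r_max" and r_max2: "r_max\<^sup>2 \<le> (r_earth + r_min)\<^sup>2 - r_earth\<^sup>2"
    unfolding r_max using max_distance_bounds assms by blast+
  have [measurable]: "G\<^sub>0 \<in> borel_measurable M" by fact
  have X: "X i \<in> borel_measurable M" if "i < N" for i
    using satellites_indep that by (auto simp: indep_vars_def)
  have [measurable]: "R\<^sub>0 \<in> borel_measurable M"
    unfolding R\<^sub>0 by (intro measurable_serving_distance X) fact
  \<comment> \<open>The horizon bound, at every distance in range: it keeps the caps below a
    hemisphere and gives \<open>q r \<le> 1\<close>, hence the sign of \<open>f\<close>.\<close>
  have le2: "r\<^sup>2 \<le> (r_earth + r_min)\<^sup>2 - r_earth\<^sup>2" if "r_min \<le> r" "r \<le> r_max" for r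
    using that pos r_max2 power_mono[of r r_max 2] by linarith
  have prob_F: "prob {\<omega> \<in> space M. R\<^sub>0 \<omega> \<le> r} = F r" if r: "r_min \<le> r" "r \<le> r_max" for r
  proof -
    have "r_earth\<^sup>2 > 0" using pos by simp
    then have "r\<^sup>2 < r_earth\<^sup>2 + (r_earth + r_min)\<^sup>2" using le2[OF r] by linarith
    then show ?thesis
      unfolding R\<^sub>0 F_def q_def using assms r by (intro prob_serving_distance_le) auto
  qed
  have q1: "q r \<le> 1" if "r_min \<le> r" "r \<le> r_max" for r
  proof -
    have "0 < r_earth * r_earth" "0 < r_earth * r_min" using pos by auto
    then have "r\<^sup>2 - r_min\<^sup>2 \<le> 4 * r_earth * (r_earth + r_min)"
      using le2[OF that] by (simp add: power2_eq_square algebra_simps)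
    then show ?thesis
      unfolding q_def using pos by (subst divide_le_eq_1_pos) auto
  qed
  have f0: "0 \<le> f r" if "r_min \<le> r" "r \<le> r_max" for r
    using q1[OF that] that pos by (simp add: f_def c_def)
  have deriv: "(F has_real_derivative f r) (at r)" for r
  proof -
    have "(q has_real_derivative r / (2 * r_earth * (r_earth + r_min))) (at r)"
      unfolding q_def using pos by (auto intro!: derivative_eq_intros)
    then show ?thesis
      unfolding F_def by (auto intro!: derivative_eq_intros simp: f_def c_def)
  qed
  have F_min: "F r_min = 0" by (simp add: F_def q_def)
  \<comment> \<open>In particular the distance is almost surely positive, as
    \<open>snr_greater_iff\<close> requires.\<close>
  have "AE \<omega> in M. R\<^sub>0 \<omega> > r_min"
    using prob_F[of r_min] r_max_ge F_min prob_eq_0[of "{\<omega> \<in> space M. R\<^sub>0 \<omega> \<le> r_min}"]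
    by (simp add: not_le)
  then have snr: "\<P>(\<omega> in M. snr p \<sigma> \<alpha> r_max (G\<^sub>0 \<omega>) (R\<^sub>0 \<omega>) > T)
      = prob (?A \<inter> {\<omega> \<in> space M. \<phi> (R\<^sub>0 \<omega>) < G\<^sub>0 \<omega>})"
  proof (intro finite_measure_eq_AE)
    show "AE \<omega> in M. \<omega> \<in> {\<omega> \<in> space M. T < snr p \<sigma> \<alpha> r_max (G\<^sub>0 \<omega>) (R\<^sub>0 \<omega>)}
        \<longleftrightarrow> \<omega> \<in> ?A \<inter> {\<omega> \<in> space M. \<phi> (R\<^sub>0 \<omega>) < G\<^sub>0 \<omega>}"
      using \<open>AE \<omega> in M. R\<^sub>0 \<omega> > r_min\<close>
      by eventually_elim (use pos assms in \<open>auto simp: snr_greater_iff \<phi>_def\<close>)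
  qed (simp_all add: snr_def \<phi>_def)
  have "\<P>(\<omega> in M. snr p \<sigma> \<alpha> r_max (G\<^sub>0 \<omega>) (R\<^sub>0 \<omega>) > T)
      = (\<integral>r. indicator {r_min..r_max} r * (f r * (1 - link_gain_cdf M R\<^sub>0 r_max G\<^sub>0 (\<phi> r))) \<partial>lborel)"
  \<comment> \<open>The two radii coincide for \<open>\<theta>_min = pi / 2\<close>, where only a
    satellite at the zenith is in range.\<close>
  proof (cases "r_max = r_min")
    case True
    \<comment> \<open>Here the link exists with probability 0 and \<^const>\<open>given_link\<close> is the zero measure.\<close>
    have "prob (?A \<inter> {\<omega> \<in> space M. \<phi> (R\<^sub>0 \<omega>) < G\<^sub>0 \<omega>}) \<le> prob ?A"
      by (intro finite_measure_mono) auto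
    then have "prob (?A \<inter> {\<omega> \<in> space M. \<phi> (R\<^sub>0 \<omega>) < G\<^sub>0 \<omega>}) = 0"
      using prob_F[of r_max] F_min True by (simp add: measure_le_0_iff)
    moreover have "(\<integral>r. indicator {r_min..r_max} r * (f r * (1 - link_gain_cdf M R\<^sub>0 r_max G\<^sub>0 (\<phi> r))) \<partial>lborel) = 0"
      using AE_lborel_singleton[of r_min] True by (intro integral_eq_zero_AE) auto
    ultimately show ?thesis by (simp add: snr)
  next
    case False
    then have "r_min < r_max" using r_max_ge by simp
    \<comment> \<open>A cap of positive area gives the link positive probability, so conditioning on
      it yields a probability measure.\<close>
    then have "q r_max > 0" using pos by (simp add: q_def power_strict_mono)
    then have "(1 - q r_max) ^ N < 1"
      using q1[of r_max] r_max_ge \<open>N \<ge> 1\<close> by (intro power_less_one_iff[THEN iffD2]) auto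
    then have F_max: "F r_max > 0" by (simp add: F_def)
    have A: "prob ?A = F r_max" using prob_F r_max_ge by simp
    have A': "emeasure M ?A \<noteq> 0" "emeasure M ?A \<noteq> \<infinity>"
      using A F_max by (auto simp: emeasure_eq_measure)
    let ?g = "\<lambda>r. f r / F r_max * indicator {r_min..r_max} r"
    have [measurable]: "f \<in> borel_measurable borel" unfolding f_def q_def by measurable
    interpret L: prob_space "given_link M R\<^sub>0 r_max"
      unfolding given_link_def by (rule prob_space_uniform_measure[OF A'])
    have "distr (given_link M R\<^sub>0 r_max) borel R\<^sub>0 = density lborel (\<lambda>r. ennreal (?g r))"
      unfolding given_link_def
      by (rule distr_uniform_measure_le_eq_density) (use r_max_ge prob_F F_min F_max deriv f0 in auto)
    then have "L.prob {\<omega> \<in> space (given_link M R\<^sub>0 r_max). \<phi> (R\<^sub>0 \<omega>) < G\<^sub>0 \<omega>}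
        = (\<integral>r. ?g r * (1 - link_gain_cdf M R\<^sub>0 r_max G\<^sub>0 (\<phi> r)) \<partial>lborel)"
      unfolding link_gain_cdf_def using f0 F_max
      by (intro L.prob_indep_var_greater gain_indep) (auto simp: \<phi>_def split: split_indicator)
    \<comment> \<open>Undoing the conditioning multiplies by \<open>F r_max\<close>, which cancels
      the normalizing constant in \<open>?g\<close>.\<close>
    also have "L.prob {\<omega> \<in> space (given_link M R\<^sub>0 r_max). \<phi> (R\<^sub>0 \<omega>) < G\<^sub>0 \<omega>}
        = prob (?A \<inter> {\<omega> \<in> space M. \<phi> (R\<^sub>0 \<omega>) < G\<^sub>0 \<omega>}) / F r_max"
      unfolding given_link_def using A A' by (subst measure_uniform_measure) (auto simp: \<phi>_def)
    finally have "prob (?A \<inter> {\<omega> \<in> space M. \<phi> (R\<^sub>0 \<omega>) < G\<^sub>0 \<omega>})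
        = F r_max * (\<integral>r. ?g r * (1 - link_gain_cdf M R\<^sub>0 r_max G\<^sub>0 (\<phi> r)) \<partial>lborel)"
      using F_max by (simp add: field_simps)
    also have "\<dots> = (\<integral>r. F r_max * (?g r * (1 - link_gain_cdf M R\<^sub>0 r_max G\<^sub>0 (\<phi> r))) \<partial>lborel)"
      by (rule integral_mult_right_zero[symmetric])
    also have "\<dots> = (\<integral>r. indicator {r_min..r_max} r * (f r * (1 - link_gain_cdf M R\<^sub>0 r_max G\<^sub>0 (\<phi> r))) \<partial>lborel)"
      using F_max by (intro Bochner_Integration.integral_cong) auto
    finally show ?thesis by (simp add: snr)
  qed
  also have "\<dots> = (\<integral>r. c * (indicator {r_min..r_max} r *\<^sub>R
      ((1 - link_gain_cdf M R\<^sub>0 r_max G\<^sub>0 (\<phi> r)) * (1 - q r) ^ (N - 1) * r)) \<partial>lborel)"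
    by (intro Bochner_Integration.integral_cong) (auto simp: f_def)
  finally show ?thesis
    unfolding set_lebesgue_integral_def \<phi>_def q_def c_def by simp
qed

end
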